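(* Let $1\le p<\infty$, let $K$ be a compact Hausdorff space, let $X,Y$ be Banach spaces, and let $m\leftrightarrow T:C(K,X)\to Y$ be an operator such that (a) $m$ is strongly bounded and admits a discrete control measure $\lambda$; (b) for every $A\in\Sigma$, $m(A):X\to Y$ is pseudo weakly compact (respectively DP $p$-convergent). Then $T$ is pseudo weakly compact (respectively DP $p$-convergent).
   Context: Operator means bounded linear map. $C(K,X)$ is the space of continuous functions $K\to X$ with the sup norm; $\Sigma$ is the Borel $\sigma$-algebra of $K$. Its dual is $rcabv(\Sigma,X^* )$, the regular countably additive $X^*$-valued Borel measures of bounded variation. Every operator $T:C(K,X)\to Y$ has a representing measure $m:\Sigma\to L(X,Y^{**})$ (written $m\leftrightarrow T$), $m(A)x=T^{**}(\chi_A x)$, where $\chi_A x\in C(K,X)^{**}$ acts on $\mu\in rcabv(\Sigma,X^* )$ by $\langle \mu(A),x\rangle$; one has $T(f)=\int_K f\,dm$. For $y^*\in Y^*$ put $y^*m=T^*(y^* )\in rcabv(\Sigma,X^* )$, so $\langle y^*m(A),x\rangle=\langle m(A)x,y^*\rangle$. The semivariation is $\tilde m(E)=\sup\{|y^*m|(E): \|y^*\|\le 1\}$, with $|\cdot|$ denoting variation. $T$ (or $m$) is strongly bounded if $\tilde m(A_i)\to 0$ for every decreasing sequence $(A_i)$ in $\Sigma$ with empty intersection; in that case $m$ takes values in $L(X,Y)$. A control measure for $m$ is a non-negative (finite) regular Borel measure $\lambda$ on $K$ such that $\tilde m(A)\to0$ as $\lambda(A)\to0$. A positive Radon measure is discrete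 if every set of positive measure contains an atom; in this case it is of the form $\sum_i a_i\delta_{t_i}$ (countable sum) with $\sum_i|a_i|<\infty$. A bounded subset $A$ of a Banach space $E$ is a Dunford-Pettis (DP) set if $\sup_{x\in A}|x_n^*(x)|\to 0$ for every weakly null sequence $(x_n^* )$ in $E^*$. A sequence $(x_n)$ in $E$ is weakly $p$-summable if $(x^*(x_n))\in\ell_p$ for all $x^*\in E^*$. A DP weakly null (resp. DP weakly $p$-summable) sequence is a weakly null (resp. weakly $p$-summable) sequence whose set of terms is a DP set. An operator is pseudo weakly compact (resp. DP $p$-convergent) if it maps DP weakly null (resp. DP weakly $p$-summable) sequences to norm null sequences. *)

theory Defs
  imports "HOL-Analysis.Analysis"
begin

section \<open>Duality\<close>

type_synonym 'a dual = "'a \<Rightarrow>\<^sub>L real"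
type_synonym 'a bidual = "'a dual dual"

lift_definition evaluation_at :: "'a::real_normed_vector \<Rightarrow> 'a bidual"
  is "\<lambda>x \<phi>. blinfun_apply \<phi> x"
  by (rule blinfun.bounded_linear_left)

lift_definition canonical_embedding :: "'a::real_normed_vector \<Rightarrow>\<^sub>L 'a bidual"
  is evaluation_at
proof (rule bounded_linear_intro[where K = 1])
  show "evaluation_at (x + y) = evaluation_at x + evaluation_at y" for x y :: 'a
    by (rule blinfun_eqI) (simp add: evaluation_at.rep_eq plus_blinfun.rep_eq blinfun.add_right)
  show "evaluation_at (r *\<^sub>R x) = r *\<^sub>R evaluation_at x" for r and x :: 'a
    by (rule blinfun_eqI) (simp add: evaluation_at.rep_eq scaleR_blinfun.rep_eq blinfun.scaleR_right)
  show "norm (evaluation_at x) \<le> norm x * 1" for x :: 'a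
  proof (rule norm_blinfun_bound)
    show "norm (evaluation_at x \<phi>) \<le> norm x * 1 * norm \<phi>" for \<phi> :: "'a dual"
      using norm_blinfun[of \<phi> x] by (simp add: evaluation_at.rep_eq mult.commute)
  qed simp
qed

section \<open>Dunford--Pettis sets and the two classes of operators\<close>

definition weakly_null :: "(nat \<Rightarrow> 'a::real_normed_vector) \<Rightarrow> bool" where
  "weakly_null x \<longleftrightarrow> (\<forall>\<phi> :: 'a dual. (\<lambda>n. \<phi> (x n)) \<longlonglongrightarrow> 0)"

definition weakly_p_summable :: "real \<Rightarrow> (nat \<Rightarrow> 'a::real_normed_vector) \<Rightarrow> bool" where
  "weakly_p_summable p x \<longleftrightarrow> (\<forall>\<phi> :: 'a dual. summable (\<lambda>n. \<bar>\<phi> (x n)\<bar> powr p))"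

definition DP_set :: "'a::real_normed_vector set \<Rightarrow> bool" where
  "DP_set A \<longleftrightarrow> bounded A \<and>
     (\<forall>\<phi> :: nat \<Rightarrow> 'a dual. weakly_null \<phi> \<longrightarrow>
        (\<lambda>n. SUP x\<in>A. ennreal \<bar>blinfun_apply (\<phi> n) x\<bar>) \<longlonglongrightarrow> 0)"

definition pseudo_weakly_compact ::
    "('a::real_normed_vector \<Rightarrow>\<^sub>L 'b::real_normed_vector) \<Rightarrow> bool" where
  "pseudo_weakly_compact T \<longleftrightarrow>
     (\<forall>x. weakly_null x \<and> DP_set (range x) \<longrightarrow> (\<lambda>n. T (x n)) \<longlonglongrightarrow> 0)"

definition DP_p_convergent ::
    "real \<Rightarrow> ('a::real_normed_vector \<Rightarrow>\<^sub>L 'b::real_normed_vector) \<Rightarrow> bool" where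
  "DP_p_convergent p T \<longleftrightarrow>
     (\<forall>x. weakly_p_summable p x \<and> DP_set (range x) \<longrightarrow> (\<lambda>n. T (x n)) \<longlonglongrightarrow> 0)"

section \<open>Vector measures on the Borel sets\<close>

text \<open>A set function is a total function on all sets; only its values on Borel sets matter.\<close>

definition variation ::
    "('k::topological_space set \<Rightarrow> 'v::real_normed_vector) \<Rightarrow> 'k set \<Rightarrow> ennreal" where
  "variation \<mu> E =
     (SUP P\<in>{P. finite P \<and> disjoint P \<and> P \<subseteq> sets borel \<and> \<Union>P = E}. \<Sum>B\<in>P. ennreal (norm (\<mu> B)))"

definition rcabv :: "('k::topological_space set \<Rightarrow> 'v::real_normed_vector) set" where
  "rcabv = {\<mu>.
     (\<forall>A :: nat \<Rightarrow> 'k set. range A \<subseteq> sets borel \<and> disjoint_family A \<longrightarrow>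
        (\<lambda>n. \<mu> (A n)) sums \<mu> (\<Union>n. A n)) \<and>
     variation \<mu> UNIV < \<infinity> \<and>
     (\<forall>A \<in> sets borel. \<forall>\<epsilon>>0. \<exists>F U. compact F \<and> open U \<and> F \<subseteq> A \<and> A \<subseteq> U \<and>
        variation \<mu> (U - F) < ennreal \<epsilon>)}"

definition simple_integral_vm ::
    "('k::topological_space set \<Rightarrow> 'x::real_normed_vector dual) \<Rightarrow> ('k \<Rightarrow> 'x) \<Rightarrow> real" where
  "simple_integral_vm \<mu> s = (\<Sum>v\<in>range s. \<mu> (s -` {v}) v)"

text \<open>For \<open>\<mu>\<close> of bounded variation the limit does not depend on the approximating sequence, and on a
  compact space every continuous \<open>f\<close> is a uniform limit of simple functions.\<close>

definition has_integral_vm ::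
    "('k::topological_space set \<Rightarrow> 'x::real_normed_vector dual) \<Rightarrow> ('k \<Rightarrow> 'x) \<Rightarrow> real \<Rightarrow> bool" where
  "has_integral_vm \<mu> f I \<longleftrightarrow>
     (\<exists>s. (\<forall>n. simple_function borel (s n)) \<and> uniform_limit UNIV s f sequentially \<and>
          (\<lambda>n. simple_integral_vm \<mu> (s n)) \<longlonglongrightarrow> I)"

text \<open>The correspondence between \<open>C(K,X)\<^sup>*\<close> and \<open>rcabv(\<Sigma>,X\<^sup>*)\<close>, as a relation.\<close>

definition represents_functional ::
    "('k::topological_space set \<Rightarrow> 'x::real_normed_vector dual) \<Rightarrow> ('k \<Rightarrow>\<^sub>C 'x) dual \<Rightarrow> bool" where
  "represents_functional \<mu> \<phi> \<longleftrightarrow> \<mu> \<in> rcabv \<and> (\<forall>f. has_integral_vm \<mu> (apply_bcontfun f) (\<phi> f))"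

section \<open>Representing measures\<close>

text \<open>\<open>scalarization y m\<close> is the \<open>X\<^sup>*\<close>-valued set function \<open>y\<^sup>*m\<close>: since \<open>m A x\<close> is an element of
  \<open>Y\<^sup>*\<^sup>*\<close>, it is \<open>A \<mapsto> (x \<mapsto> m A x y\<^sup>*)\<close>.\<close>

definition scalarization ::
    "'y::real_normed_vector dual \<Rightarrow> ('k set \<Rightarrow> ('x::real_normed_vector \<Rightarrow>\<^sub>L 'y bidual)) \<Rightarrow>
     'k set \<Rightarrow> 'x dual" where
  "scalarization y m A = evaluation_at y o\<^sub>L m A"

text \<open>Unfolding \<open>m(A)x = T\<^sup>*\<^sup>*(\<chi>\<^sub>A x)\<close> at \<open>y\<^sup>*\<close>: the value \<open>m A x y\<^sup>*\<close> is \<open>\<chi>\<^sub>A x\<close> applied to the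
  functional \<open>T\<^sup>* y\<^sup>* = y\<^sup>* \<circ> T\<close>, that is, \<open>\<mu> A x\<close> for the measure \<open>\<mu>\<close> representing that functional.\<close>

definition representing_measure ::
    "('k::topological_space set \<Rightarrow> ('x::real_normed_vector \<Rightarrow>\<^sub>L 'y bidual)) \<Rightarrow>
     (('k \<Rightarrow>\<^sub>C 'x) \<Rightarrow>\<^sub>L 'y::real_normed_vector) \<Rightarrow> bool" where
  "representing_measure m T \<longleftrightarrow>
     (\<forall>y :: 'y dual. \<exists>\<mu>. represents_functional \<mu> (y o\<^sub>L T) \<and>
        (\<forall>A \<in> sets borel. \<forall>x. m A x y = \<mu> A x))"

definition semivariation ::
    "('k::topological_space set \<Rightarrow> ('x::real_normed_vector \<Rightarrow>\<^sub>L 'y::real_normed_vector bidual)) \<Rightarrow>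
     'k set \<Rightarrow> ennreal" where
  "semivariation m E = (SUP y\<in>{y :: 'y dual. norm y \<le> 1}. variation (scalarization y m) E)"

definition strongly_bounded ::
    "('k::topological_space set \<Rightarrow> ('x::real_normed_vector \<Rightarrow>\<^sub>L 'y::real_normed_vector bidual)) \<Rightarrow>
     bool" where
  "strongly_bounded m \<longleftrightarrow>
     (\<forall>A :: nat \<Rightarrow> 'k set. range A \<subseteq> sets borel \<and> decseq A \<and> (\<Inter>i. A i) = {} \<longrightarrow>
        (\<lambda>i. semivariation m (A i)) \<longlonglongrightarrow> 0)"

section \<open>Discrete control measures\<close>

definition regular_borel_measure :: "'k::topological_space measure \<Rightarrow> bool" where
  "regular_borel_measure \<nu> \<longleftrightarrow> sets \<nu> = sets borel \<and> finite_measure \<nu> \<and>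
     (\<forall>A \<in> sets borel. \<forall>\<epsilon>>0. \<exists>F U. compact F \<and> open U \<and> F \<subseteq> A \<and> A \<subseteq> U \<and>
        emeasure \<nu> (U - F) < ennreal \<epsilon>)"

definition control_measure ::
    "'k::topological_space measure \<Rightarrow>
     ('k set \<Rightarrow> ('x::real_normed_vector \<Rightarrow>\<^sub>L 'y::real_normed_vector bidual)) \<Rightarrow> bool" where
  "control_measure \<nu> m \<longleftrightarrow> regular_borel_measure \<nu> \<and>
     (\<forall>\<epsilon>>0. \<exists>\<delta>>0. \<forall>A \<in> sets borel.
        emeasure \<nu> A < ennreal \<delta> \<longrightarrow> semivariation m A < ennreal \<epsilon>)"

definition atom_of :: "'k measure \<Rightarrow> 'k set \<Rightarrow> bool" where
  "atom_of \<nu> B \<longleftrightarrow> B \<in> sets \<nu> \<and> emeasure \<nu> B > 0 \<and>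
     (\<forall>C \<in> sets \<nu>. C \<subseteq> B \<longrightarrow> emeasure \<nu> C = 0 \<or> emeasure \<nu> (B - C) = 0)"

definition discrete_measure :: "'k measure \<Rightarrow> bool" where
  "discrete_measure \<nu> \<longleftrightarrow>
     (\<forall>A \<in> sets \<nu>. emeasure \<nu> A > 0 \<longrightarrow> (\<exists>B. B \<subseteq> A \<and> atom_of \<nu> B))"

end

(* A regular finite measure on a compact Hausdorff space has each of its atoms concentrated, up to a
   null set, at one point, so the discrete control measure is carried by countably many points.
   Hence for every epsilon there is a finite set F of points whose complement has semivariation at
   most epsilon, and norm (T f) is at most the sum over t in F of norm (m {t} (f t)) plus
   epsilon * norm f.  Evaluation at t is a bounded operator from C(K,X) to X, so it preserves DP
   weakly null and DP weakly p-summable sequences, and the finitely many summands tend to 0 along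
   such a sequence by the hypothesis on m {t}. *)

theory Submission
  imports Defs
begin

section \<open>The Hahn--Banach theorem\<close>

text \<open>Homogeneity is required only as an inequality and only for positive \<open>t\<close>.
  Applying it to \<open>1/t\<close> recovers equality, so for functionals built as infima a single
  inequality has to be checked.\<close>

definition sublinear :: "('a::real_vector \<Rightarrow> real) \<Rightarrow> bool" where
  "sublinear q \<longleftrightarrow> (\<forall>x y. q (x + y) \<le> q x + q y) \<and> (\<forall>t>0. \<forall>x. q (t *\<^sub>R x) \<le> t * q x)"

lemma sublinear_add: "sublinear q \<Longrightarrow> q (x + y) \<le> q x + q y"
  by (simp add: sublinear_def)

lemma sublinear_zero: assumes "sublinear q" shows "q 0 = 0"
proof -
  have "q ((1/2) *\<^sub>R 0) \<le> (1/2) * q 0"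
    using assms unfolding sublinear_def by (metis half_gt_zero_iff zero_less_one)
  moreover have "q (0 + 0) \<le> q 0 + q 0"
    using assms by (rule sublinear_add)
  ultimately show ?thesis by simp
qed

lemma sublinear_scaleR:
  assumes "sublinear q" "t \<ge> 0" shows "q (t *\<^sub>R x) = t * q x"
proof (cases "t = 0")
  case True
  then show ?thesis using sublinear_zero[OF assms(1)] by simp
next
  case False
  then have t: "t > 0" using assms by simp
  then have "q ((1/t) *\<^sub>R (t *\<^sub>R x)) \<le> (1/t) * q (t *\<^sub>R x)"
    using assms(1) unfolding sublinear_def by (meson zero_less_divide_1_iff)
  then have "t * q x \<le> q (t *\<^sub>R x)" using t by (simp add: field_simps)
  moreover have "q (t *\<^sub>R x) \<le> t * q x" using assms t by (simp add: sublinear_def)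
  ultimately show ?thesis by simp
qed

lemma sublinear_minus: assumes "sublinear q" shows "- q (- x) \<le> q x"
  using sublinear_add[OF assms, of x "-x"] sublinear_zero[OF assms] by simp

text \<open>Serves to prove subadditivity of functionals that are infima: the two indices vary
  independently, so they can be minimised one after the other.\<close>

lemma le_cINF_add:
  fixes f :: "'i \<Rightarrow> real" and g :: "'j \<Rightarrow> real"
  assumes "I \<noteq> {}" "J \<noteq> {}" "\<And>i j. i \<in> I \<Longrightarrow> j \<in> J \<Longrightarrow> z \<le> f i + g j"
  shows "z \<le> (INF i\<in>I. f i) + (INF j\<in>J. g j)"
proof -
  have "z - f i \<le> (INF j\<in>J. g j)" if "i \<in> I" for i
    by (rule cINF_greatest[OF assms(2)]) (use assms(3)[OF that] in \<open>simp add: algebra_simps\<close>)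
  then have "z - (INF j\<in>J. g j) \<le> (INF i\<in>I. f i)"
    by (intro cINF_greatest[OF assms(1)]) (simp add: algebra_simps)
  then show ?thesis by simp
qed

lemma le_mult_cINF:
  fixes f :: "'i \<Rightarrow> real"
  assumes "I \<noteq> {}" "0 < t" "\<And>i. i \<in> I \<Longrightarrow> z \<le> t * f i"
  shows "z \<le> t * (INF i\<in>I. f i)"
proof -
  have "z / t \<le> (INF i\<in>I. f i)"
    by (rule cINF_greatest[OF assms(1)]) (use assms in \<open>simp add: divide_le_eq mult.commute\<close>)
  then show ?thesis using assms(2) by (simp add: divide_le_eq mult.commute)
qed

text \<open>Lowering \<open>q\<close> in the direction \<open>y\<close>: a minimal sublinear functional equals its own lowering, which
  forces additivity; and a linear functional below the lowering of the norm at \<open>z\<close> norms \<open>z\<close>.\<close>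

lemma sublinear_lower:
  fixes q :: "'a::real_vector \<Rightarrow> real" and y :: 'a
  assumes q: "sublinear q"
  defines "r \<equiv> \<lambda>x. INF t\<in>{0..}. q (x + t *\<^sub>R y) - t * q y"
  shows "sublinear r" "t \<ge> 0 \<Longrightarrow> r x \<le> q (x + t *\<^sub>R y) - t * q y"
proof -
  \<comment> \<open>The bound \<open>- q (- x)\<close> does not depend on \<open>t\<close>, so the
    real infimum defining \<open>r\<close> is a genuine one.\<close>
  have bdd: "bdd_below ((\<lambda>t. q (x + t *\<^sub>R y) - t * q y) ` {0..})" for x
  proof (rule bdd_belowI2)
    fix t :: real assume "t \<in> {0..}"
    then have "q (t *\<^sub>R y) = t * q y" using sublinear_scaleR[OF q] by simp
    moreover have "q ((x + t *\<^sub>R y) + - x) \<le> q (x + t *\<^sub>R y) + q (- x)"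
      by (rule sublinear_add[OF q])
    ultimately show "- q (- x) \<le> q (x + t *\<^sub>R y) - t * q y" by simp
  qed
  have r_eq: "r x = (INF t\<in>{0..}. q (x + t *\<^sub>R y) - t * q y)" for x
    by (simp add: r_def)
  show le: "r x \<le> q (x + t *\<^sub>R y) - t * q y" if "t \<ge> 0" for x t
    unfolding r_def by (rule cINF_lower[OF bdd]) (use that in simp)
  show "sublinear r"
    unfolding sublinear_def
  proof (intro conjI allI impI)
    fix a b
    \<comment> \<open>The parameters \<open>t\<close> for \<open>a\<close> and \<open>s\<close> for
      \<open>b\<close> are merged into \<open>t + s\<close> for \<open>a + b\<close>.\<close>
    have "r (a + b) \<le> (q (a + t *\<^sub>R y) - t * q y) + (q (b + s *\<^sub>R y) - s * q y)"
      if "t \<in> {0..}" "s \<in> {0..}" for s t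
    proof -
      have "r (a + b) \<le> q ((a + b) + (t + s) *\<^sub>R y) - (t + s) * q y"
        using that by (intro le) simp
      also have "(a + b) + (t + s) *\<^sub>R y = (a + t *\<^sub>R y) + (b + s *\<^sub>R y)"
        by (simp add: algebra_simps)
      also have "q \<dots> \<le> q (a + t *\<^sub>R y) + q (b + s *\<^sub>R y)"
        by (rule sublinear_add[OF q])
      finally show ?thesis by (simp add: algebra_simps)
    qed
    then show "r (a + b) \<le> r a + r b"
      unfolding r_eq[of a] r_eq[of b]
      by (intro le_cINF_add) auto
  next
    fix c :: real and x assume c: "c > 0"
    have "r (c *\<^sub>R x) \<le> c * (q (x + t *\<^sub>R y) - t * q y)" if "t \<in> {0..}" for t
    proof -
      have "r (c *\<^sub>R x) \<le> q (c *\<^sub>R x + (c * t) *\<^sub>R y) - (c * t) * q y"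
        using that c by (intro le) simp
      also have "c *\<^sub>R x + (c * t) *\<^sub>R y = c *\<^sub>R (x + t *\<^sub>R y)"
        by (simp add: algebra_simps)
      also have "q \<dots> = c * q (x + t *\<^sub>R y)"
        using c by (intro sublinear_scaleR[OF q]) simp
      finally show ?thesis by (simp add: algebra_simps)
    qed
    then show "r (c *\<^sub>R x) \<le> c * r x"
      unfolding r_eq[of x] by (intro le_mult_cINF c) auto
  qed
qed

text \<open>Zorn's lemma for the reversed pointwise order on the sublinear functionals below
  \<open>p\<close>. A nonempty chain is bounded by its pointwise infimum, which is finite because
  every member at \<open>x\<close> is at least \<open>- p (- x)\<close>.\<close>

lemma sublinear_minimal:
  fixes p :: "'a::real_vector \<Rightarrow> real"
  assumes p: "sublinear p"
  obtains q where "sublinear q" "q \<le> p" "\<And>r. sublinear r \<Longrightarrow> r \<le> q \<Longrightarrow> r = q"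
proof -
  let ?A = "{q. sublinear q \<and> q \<le> p}"
  have "\<exists>u\<in>?A. \<forall>a\<in>?A. a \<le> u \<longrightarrow> a = u"
  proof (rule predicate_Zorn)
    show "partial_order_on ?A (relation_of (\<lambda>a b. b \<le> a) ?A)"
      by (rule partial_order_on_relation_ofI) auto
    fix C assume C: "C \<in> Chains (relation_of (\<lambda>a b. b \<le> a) ?A)"
    then have CA: "C \<subseteq> ?A" by (rule Chains_relation_of)
    show "\<exists>u\<in>?A. \<forall>a\<in>C. u \<le> a"
    proof (cases "C = {}")
      case True
      with p show ?thesis by auto
    next
      case False
      have bdd: "bdd_below ((\<lambda>q. q x) ` C)" for x
      proof (rule bdd_belowI2)
        fix q assume "q \<in> C"
        then have "sublinear q" "q (- x) \<le> p (- x)" using CA by (auto simp: le_fun_def)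
        then show "- p (- x) \<le> q x" using sublinear_minus[of q x] by simp
      qed
      define u where "u x = (INF q\<in>C. q x)" for x
      have le: "u x \<le> q x" if "q \<in> C" for q x
        unfolding u_def by (rule cINF_lower[OF bdd that])
      have "sublinear u"
        unfolding sublinear_def
      proof (intro conjI allI impI)
        fix x y
        have "u (x + y) \<le> q x + r y" if qr: "q \<in> C" "r \<in> C" for q r
        proof -
          \<comment> \<open>The infima at \<open>x\<close> and at \<open>y\<close> may be approached
            by different members of the chain; comparability provides one member below both, and its
            subadditivity applies.\<close>
          have "q \<le> r \<or> r \<le> q"
            using C qr by (auto simp: Chains_def relation_of_def)
          then obtain s where s: "s \<in> C" "s \<le> q" "s \<le> r" using qr by auto
          have "u (x + y) \<le> s (x + y)" by (rule le[OF s(1)])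
          also have "\<dots> \<le> s x + s y" using s(1) CA by (intro sublinear_add) auto
          also have "\<dots> \<le> q x + r y" using s by (intro add_mono) (auto simp: le_fun_def)
          finally show ?thesis .
        qed
        then show "u (x + y) \<le> u x + u y"
          unfolding u_def[of x] u_def[of y] by (intro le_cINF_add False)
      next
        fix t :: real and x assume t: "t > 0"
        have "u (t *\<^sub>R x) \<le> t * q x" if "q \<in> C" for q
          using le[OF that, of "t *\<^sub>R x"] sublinear_scaleR[of q t x] that CA t by auto
        then show "u (t *\<^sub>R x) \<le> t * u x"
          unfolding u_def[of x] by (intro le_mult_cINF t False)
      qed
      moreover have "u \<le> p"
      proof -
        obtain q where "q \<in> C" using False by auto
        then show ?thesis using le[of q] CA by (force simp: le_fun_def intro: order_trans)
      qed
      ultimately show ?thesis using le by (auto simp: le_fun_def)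
    qed
  qed
  then obtain u where u: "u \<in> ?A" "\<forall>a\<in>?A. a \<le> u \<longrightarrow> a = u" by blast
  then have min: "r = u" if "sublinear r" "r \<le> u" for r
  proof -
    have "r \<le> p" using that(2) u(1) by (blast intro: order_trans)
    then show ?thesis using u(2) that by blast
  qed
  show thesis by (rule that[of u]) (use u(1) min in auto)
qed

text \<open>A minimal sublinear functional \<open>q\<close> below \<open>p\<close> is already
  linear. Its lowering in direction \<open>y\<close> lies below it, hence equals it, and the
  parameter \<open>t = 1\<close> then yields the reverse of subadditivity.\<close>

lemma hahn_banach_sublinear:
  fixes p :: "'a::real_vector \<Rightarrow> real"
  assumes p: "sublinear p"
  obtains f where "linear f" "\<And>x. f x \<le> p x"
proof -
  obtain q where q: "sublinear q" "q \<le> p" and min: "\<And>r. sublinear r \<Longrightarrow> r \<le> q \<Longrightarrow> r = q"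
    using sublinear_minimal[OF p] by blast
  have add: "q (x + y) = q x + q y" for x y
  proof -
    define r where "r = (\<lambda>x. INF t\<in>{0..}. q (x + t *\<^sub>R y) - t * q y)"
    have r: "sublinear r" and le: "\<And>t x. t \<ge> 0 \<Longrightarrow> r x \<le> q (x + t *\<^sub>R y) - t * q y"
      unfolding r_def using sublinear_lower[OF q(1), where y = y] by auto
    have "r \<le> q" using le[of 0] by (simp add: le_fun_def)
    then have "r = q" by (rule min[OF r])
    then have "q x + q y \<le> q (x + y)" using le[of 1 x] by simp
    then show ?thesis using sublinear_add[OF q(1), of x y] by simp
  qed
  have neg: "q (- x) = - q x" for x
    using add[of x "-x"] sublinear_zero[OF q(1)] by simp
  have "linear q"
  proof (rule linearI)
    fix c x
    show "q (c *\<^sub>R x) = c *\<^sub>R q x"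
    proof (cases "c \<ge> 0")
      case True
      then show ?thesis using sublinear_scaleR[OF q(1)] by simp
    next
      case False
      then show ?thesis using sublinear_scaleR[OF q(1), of "-c" x] neg[of "c *\<^sub>R x"] by simp
    qed
  qed (rule add)
  then show thesis using q(2) by (intro that) (auto simp: le_fun_def)
qed

text \<open>Rather than extending a functional from the span of \<open>z\<close>, the proof
  dominates a linear functional by the norm lowered in direction \<open>z\<close>, which builds the
  value at \<open>z\<close> into the bound.\<close>

lemma norming_functional:
  fixes z :: "'a::real_normed_vector"
  obtains y :: "'a dual" where "norm y \<le> 1" "y z = norm z"
proof -
  have n: "sublinear (norm :: 'a \<Rightarrow> real)"
    by (auto simp: sublinear_def norm_triangle_ineq)
  define r where "r = (\<lambda>x. INF t\<in>{0..}. norm (x + t *\<^sub>R z) - t * norm z)"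
  have r: "sublinear r" and le: "\<And>t x. t \<ge> 0 \<Longrightarrow> r x \<le> norm (x + t *\<^sub>R z) - t * norm z"
    unfolding r_def using sublinear_lower[OF n, where y = z] by auto
  obtain f where f: "linear f" "\<And>x. f x \<le> r x"
    using hahn_banach_sublinear[OF r] by blast
  have fn: "f x \<le> norm x" for x using f(2)[of x] le[of 0 x] by simp
  have fabs: "norm (f x) \<le> norm x * 1" for x
    using fn[of x] fn[of "-x"] linear_neg[OF f(1), of x] by simp
  have bl: "bounded_linear f"
    using f(1) fabs by (intro bounded_linear.intro bounded_linear_axioms.intro exI[of _ 1]) auto
  \<comment> \<open>At \<open>-z\<close> with \<open>t = 1\<close> the vector inside the norm
    vanishes, so the lowering is at most \<open>- norm z\<close>.\<close>
  have "f (- z) \<le> - norm z" using f(2)[of "-z"] le[of 1 "-z"] by simp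
  then have "f z = norm z" using fn[of z] linear_neg[OF f(1), of z] by simp
  moreover have "norm (Blinfun f) \<le> 1"
    by (rule norm_blinfun_bound) (use fabs in \<open>simp_all add: bounded_linear_Blinfun_apply[OF bl]\<close>)
  ultimately show thesis by (intro that[of "Blinfun f"]) (simp_all add: bounded_linear_Blinfun_apply[OF bl])
qed

section \<open>Images of Dunford--Pettis sequences\<close>

lemma weakly_null_image:
  fixes L :: "'a::real_normed_vector \<Rightarrow>\<^sub>L 'b::real_normed_vector"
  assumes "weakly_null x" shows "weakly_null (\<lambda>n. L (x n))"
  unfolding weakly_null_def
proof
  fix \<phi> :: "'b dual"
  show "(\<lambda>n. \<phi> (L (x n))) \<longlonglongrightarrow> 0"
    using assms[unfolded weakly_null_def, THEN spec, of "\<phi> o\<^sub>L L"] by simp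
qed

lemma weakly_p_summable_image:
  fixes L :: "'a::real_normed_vector \<Rightarrow>\<^sub>L 'b::real_normed_vector"
  assumes "weakly_p_summable p x" shows "weakly_p_summable p (\<lambda>n. L (x n))"
  unfolding weakly_p_summable_def
proof
  fix \<phi> :: "'b dual"
  show "summable (\<lambda>n. \<bar>\<phi> (L (x n))\<bar> powr p)"
    using assms[unfolded weakly_p_summable_def, THEN spec, of "\<phi> o\<^sub>L L"] by simp
qed

text \<open>The supremum of \<open>\<phi> n\<close> over the image of \<open>A\<close> is the
  supremum of its adjoint image over \<open>A\<close>. The adjoint is itself bounded and linear, so
  it keeps the sequence of functionals weakly null.\<close>

lemma DP_set_image:
  fixes L :: "'a::real_normed_vector \<Rightarrow>\<^sub>L 'b::real_normed_vector"
  assumes A: "DP_set A" shows "DP_set (L ` A)"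
  unfolding DP_set_def
proof (intro conjI allI impI)
  show "bounded (L ` A)"
    using A by (auto simp: DP_set_def intro: bounded_linear_image blinfun.bounded_linear_right)
  fix \<phi> :: "nat \<Rightarrow> 'b dual" assume \<phi>: "weakly_null \<phi>"
  define adj :: "'b dual \<Rightarrow>\<^sub>L 'a dual" where "adj = Blinfun (\<lambda>\<psi>. \<psi> o\<^sub>L L)"
  have adj: "adj \<psi> = \<psi> o\<^sub>L L" for \<psi>
    unfolding adj_def
    by (simp add: bounded_linear_Blinfun_apply bounded_bilinear.bounded_linear_left
        bounded_bilinear_blinfun_compose)
  have "(\<lambda>n. SUP x\<in>A. ennreal \<bar>adj (\<phi> n) x\<bar>) \<longlonglongrightarrow> 0"
    using A weakly_null_image[OF \<phi>, of adj] by (simp add: DP_set_def)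
  then show "(\<lambda>n. SUP x\<in>L ` A. ennreal \<bar>\<phi> n x\<bar>) \<longlonglongrightarrow> 0"
    by (simp add: adj image_image)
qed

lemma bounded_linear_bcontfun_eval:
  "bounded_linear (\<lambda>f :: 'k::topological_space \<Rightarrow>\<^sub>C 'x::real_normed_vector. apply_bcontfun f t)"
  by (rule bounded_linear_intro[where K = 1]) (auto simp: norm_bounded)

section \<open>Discrete regular measures\<close>

text \<open>Regularity shrinks the atom to a compact \<open>F\<close> of positive measure.
  Compactness gives a point \<open>t\<close> all of whose neighbourhoods meet \<open>F\<close> in
  positive measure, and indivisibility of the atom forces all the mass of \<open>F\<close> onto
  \<open>t\<close>.\<close>

lemma atom_concentrated_at_point:
  fixes \<nu> :: "'k::t2_space measure"
  assumes K: "compact (UNIV :: 'k set)" and \<nu>: "regular_borel_measure \<nu>" and B: "atom_of \<nu> B"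
  obtains t where "t \<in> B" "emeasure \<nu> {t} > 0"
proof -
  have sets: "sets \<nu> = sets borel" and fin: "finite_measure \<nu>"
    using \<nu> by (auto simp: regular_borel_measure_def)
  interpret finite_measure \<nu> by (rule fin)
  have meas: "A \<in> sets \<nu>" if "closed A \<or> open A" for A
    using that by (auto simp: sets)
  have reg: "\<exists>F. compact F \<and> F \<subseteq> A \<and> emeasure \<nu> F > 0"
    if A: "A \<in> sets \<nu>" "emeasure \<nu> A > 0" for A
  proof -
    \<comment> \<open>The tolerance is the full mass of \<open>A\<close>: if \<open>F\<close> were
      null, \<open>U - F\<close> would carry the mass of \<open>U\<close>, which is at least that of
      \<open>A\<close>.\<close>
    define \<epsilon> where "\<epsilon> = measure \<nu> A"
    have \<epsilon>: "\<epsilon> > 0" "emeasure \<nu> A = ennreal \<epsilon>"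
      using A by (auto simp: \<epsilon>_def emeasure_eq_measure)
    obtain F U where F: "compact F" "open U" "F \<subseteq> A" "A \<subseteq> U" "emeasure \<nu> (U - F) < ennreal \<epsilon>"
      using \<nu> A(1) \<epsilon>(1) unfolding regular_borel_measure_def sets by meson
    have Fm: "F \<in> sets \<nu>" "U \<in> sets \<nu>" using F by (auto intro!: meas compact_imp_closed)
    have "emeasure \<nu> F \<noteq> 0"
    proof
      assume "emeasure \<nu> F = 0"
      then have "emeasure \<nu> (U - F) = emeasure \<nu> U"
        using Fm by (intro emeasure_Diff_null_set) auto
      moreover have "emeasure \<nu> A \<le> emeasure \<nu> U" using F Fm by (intro emeasure_mono) auto
      ultimately show False using F(5) \<epsilon>(2) by simp
    qed
    then show ?thesis using F by (auto simp: zero_less_iff_neq_zero)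
  qed
  obtain F where F: "compact F" "F \<subseteq> B" "emeasure \<nu> F > 0"
    using reg[of B] B by (auto simp: atom_of_def)
  have Fm: "F \<in> sets \<nu>" using F by (auto intro!: meas compact_imp_closed)
  have Fatom: "emeasure \<nu> C = 0 \<or> emeasure \<nu> (F - C) = 0" if "C \<in> sets \<nu>" "C \<subseteq> F" for C
  proof -
    have "emeasure \<nu> (F - C) \<le> emeasure \<nu> (B - C)"
      using F B that by (intro emeasure_mono) (auto simp: atom_of_def)
    then show ?thesis using B that F unfolding atom_of_def by (metis le_zero_eq order_trans)
  qed
  have "\<exists>t\<in>F. \<forall>U. open U \<and> t \<in> U \<longrightarrow> emeasure \<nu> (F \<inter> U) > 0"
  proof (rule ccontr)
    assume "\<not> ?thesis"
    then obtain U where U: "\<And>t. t \<in> F \<Longrightarrow> open (U t) \<and> t \<in> U t \<and> emeasure \<nu> (F \<inter> U t) = 0"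
      by (metis zero_less_iff_neq_zero)
    obtain C where C: "C \<subseteq> F" "finite C" "F \<subseteq> (\<Union>c\<in>C. U c)"
      using compactE_image[OF F(1), of F U] U by blast
    have "F = (\<Union>c\<in>C. F \<inter> U c)" using C by auto
    moreover have "(\<Union>c\<in>C. F \<inter> U c) \<in> null_sets \<nu>"
    proof (rule null_sets.finite_UN[OF C(2)])
      fix c assume "c \<in> C"
      then have c: "open (U c)" "emeasure \<nu> (F \<inter> U c) = 0" using C(1) U by auto
      then show "F \<inter> U c \<in> null_sets \<nu>" by (intro null_setsI sets.Int[OF Fm] meas) auto
    qed
    ultimately show False using F(3) by auto
  qed
  then obtain t where t: "t \<in> F" and tU: "\<And>U. open U \<Longrightarrow> t \<in> U \<Longrightarrow> emeasure \<nu> (F \<inter> U) > 0"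
    by blast
  have tm: "{t} \<in> sets \<nu>" by (intro meas) simp
  have "emeasure \<nu> (F - {t}) = 0"
  proof (rule ccontr)
    assume "emeasure \<nu> (F - {t}) \<noteq> 0"
    then obtain G where G: "compact G" "G \<subseteq> F - {t}" "emeasure \<nu> G > 0"
      using reg[of "F - {t}"] Fm tm by (auto simp: zero_less_iff_neq_zero)
    have Gc: "closed G" using G(1) by (rule compact_imp_closed)
    \<comment> \<open>The complement of \<open>G\<close> is an open neighbourhood of
      \<open>t\<close>, so \<open>G\<close> and \<open>F - G\<close> both have positive measure,
      contradicting \<open>Fatom\<close>.\<close>
    have "emeasure \<nu> (F \<inter> - G) > 0" using G Gc by (intro tU) auto
    moreover have "G \<in> sets \<nu>" "G \<subseteq> F" using Gc G by (auto intro: meas)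
    ultimately show False using Fatom[of G] G(3) by (auto simp: Diff_eq)
  qed
  then have "emeasure \<nu> (F - (F - {t})) = emeasure \<nu> F"
    using Fm tm by (intro emeasure_Diff_null_set) auto
  moreover have "F - (F - {t}) = {t}" using t by auto
  ultimately show thesis using t F by (intro that[of t]) auto
qed

text \<open>The points of positive mass form a countable set \<open>D\<close>, and its complement is
  null because an atom inside it would contain such a point. Exhausting \<open>D\<close> by finite
  sets and continuity from above give the estimate.\<close>

lemma discrete_measure_finite_approx:
  fixes \<nu> :: "'k::t2_space measure"
  assumes K: "compact (UNIV :: 'k set)" and \<nu>: "regular_borel_measure \<nu>"
    and d: "discrete_measure \<nu>" and "\<delta> > 0"
  obtains F where "finite F" "emeasure \<nu> (- F) < ennreal \<delta>"
proof -
  have sets: "sets \<nu> = sets borel" and fin: "finite_measure \<nu>"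
    using \<nu> by (auto simp: regular_borel_measure_def)
  interpret finite_measure \<nu> by (rule fin)
  define D where "D = {t. measure \<nu> {t} \<noteq> 0}"
  have D: "countable D" unfolding D_def by (rule countable_support)
  have cm: "- A \<in> sets \<nu>" if "countable A" for A :: "'k set"
  proof -
    have "A \<in> sets borel" by (rule sets.countable) (use that in auto)
    then show ?thesis by (auto simp: sets)
  qed
  have D0: "emeasure \<nu> (- D) = 0"
  proof (rule ccontr)
    assume "emeasure \<nu> (- D) \<noteq> 0"
    then obtain B where B: "B \<subseteq> - D" "atom_of \<nu> B"
      using d cm[OF D] unfolding discrete_measure_def by (auto simp: zero_less_iff_neq_zero)
    obtain t where "t \<in> B" "emeasure \<nu> {t} > 0"
      using atom_concentrated_at_point[OF K \<nu> B(2)] by blast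
    then show False using B(1) by (auto simp: D_def emeasure_eq_measure)
  qed
  define F where "F n = {t \<in> D. to_nat_on D t < n}" for n
  have F: "finite (F n)" for n
  proof -
    have "inj_on (to_nat_on D) (F n)"
      using D by (intro inj_on_subset[OF inj_on_to_nat_on]) (auto simp: F_def)
    moreover have "finite (to_nat_on D ` F n)"
      by (rule finite_subset[of _ "{..<n}"]) (auto simp: F_def)
    ultimately show ?thesis by (simp add: finite_image_iff)
  qed
  have "(\<lambda>n. emeasure \<nu> (- F n)) \<longlonglongrightarrow> emeasure \<nu> (\<Inter>n. - F n)"
    by (rule Lim_emeasure_decseq)
      (auto intro!: cm countable_finite[OF F] simp: decseq_def, auto simp: F_def)
  also have "(\<Inter>n. - F n) = - D" by (auto simp: F_def)
  finally have "\<forall>\<^sub>F n in sequentially. emeasure \<nu> (- F n) < ennreal \<delta>"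
    using \<open>\<delta> > 0\<close> by (intro order_tendstoD(2)[of _ "emeasure \<nu> (- D)"]) (auto simp: D0)
  then obtain n where "emeasure \<nu> (- F n) < ennreal \<delta>"
    by (auto simp: eventually_sequentially)
  then show thesis using F by (rule that[rotated])
qed

section \<open>Integrals against measures of bounded variation\<close>

lemma rcabv_sums:
  "\<mu> \<in> rcabv \<Longrightarrow> range A \<subseteq> sets borel \<Longrightarrow> disjoint_family A \<Longrightarrow>
    (\<lambda>n. \<mu> (A n)) sums \<mu> (\<Union>n. A n)"
  unfolding rcabv_def by blast

lemma rcabv_empty: assumes "\<mu> \<in> rcabv" shows "\<mu> {} = 0"
proof -
  \<comment> \<open>A convergent series with constant terms has zero terms.\<close>
  have "(\<lambda>n::nat. \<mu> {}) sums \<mu> (\<Union>n::nat. {})"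
    by (rule rcabv_sums[OF assms]) (auto simp: disjoint_family_on_def)
  then have "(\<lambda>n::nat. \<mu> {}) \<longlonglongrightarrow> 0" by (intro summable_LIMSEQ_zero) (rule sums_summable)
  then show ?thesis by (simp add: LIMSEQ_const_iff)
qed

lemma rcabv_Un:
  assumes \<mu>: "\<mu> \<in> rcabv" and A: "A \<in> sets borel" "B \<in> sets borel" "A \<inter> B = {}"
  shows "\<mu> (A \<union> B) = \<mu> A + \<mu> B"
proof -
  have "(\<lambda>n. \<mu> (binaryset A B n)) sums \<mu> (\<Union>n. binaryset A B n)"
  proof (rule rcabv_sums[OF \<mu>])
    show "range (binaryset A B) \<subseteq> sets borel" using A by (simp add: range_binaryset_eq)
    show "disjoint_family (binaryset A B)"
      using A by (auto simp: disjoint_family_on_def binaryset_def)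
  qed
  moreover have "(\<lambda>n. \<mu> (binaryset A B n)) sums (\<mu> A + \<mu> B)"
    using rcabv_empty[OF \<mu>] by (rule binaryset_sums)
  ultimately show ?thesis unfolding UN_binaryset_eq by (rule sums_unique2)
qed

text \<open>Separates the point masses on \<open>F\<close> from the remainder. Since
  \<open>F\<close> may leave \<open>A\<close>, each point is tested for membership.\<close>

lemma rcabv_split_finite:
  fixes \<mu> :: "'k::t2_space set \<Rightarrow> 'v::real_normed_vector"
  assumes \<mu>: "\<mu> \<in> rcabv" and A: "A \<in> sets borel" and "finite F"
  shows "\<mu> A = (\<Sum>t\<in>F. if t \<in> A then \<mu> {t} else 0) + \<mu> (A - F)"
  using \<open>finite F\<close>
proof induction
  case (insert t F)
  have m: "A - insert t F \<in> sets borel"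
    using insert(1) A by (intro sets.Diff) (auto intro!: borel_closed finite_imp_closed)
  have "\<mu> (A - F) = (if t \<in> A then \<mu> {t} else 0) + \<mu> (A - insert t F)"
  proof (cases "t \<in> A")
    case True
    then have "A - F = {t} \<union> (A - insert t F)" using insert(2) by auto
    moreover have "\<mu> \<dots> = \<mu> {t} + \<mu> (A - insert t F)"
      using m by (intro rcabv_Un[OF \<mu>]) auto
    ultimately show ?thesis using True by simp
  next
    case False
    then have "A - insert t F = A - F" by auto
    then show ?thesis using False by simp
  qed
  then show ?case using insert by (simp add: algebra_simps)
qed simp

text \<open>Variation is defined through finite sets of sets, whereas level sets come as an indexed
  family. Passing between them is harmless: a disjoint family can repeat only the empty set, whose
  term is zero.\<close>

lemma sum_norm_le_variation:
  assumes "\<mu> {} = 0" "finite I" "disjoint_family_on A I" "\<And>i. i \<in> I \<Longrightarrow> A i \<in> sets borel"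
  shows "(\<Sum>i\<in>I. ennreal (norm (\<mu> (A i)))) \<le> variation \<mu> (\<Union>i\<in>I. A i)"
proof -
  have "(\<Sum>i\<in>I. ennreal (norm (\<mu> (A i)))) = (\<Sum>B\<in>A ` I. ennreal (norm (\<mu> B)))"
  proof (subst sum.reindex_nontrivial[OF assms(2)])
    fix i j assume "i \<in> I" "j \<in> I" "i \<noteq> j" "A i = A j"
    then have "A i = {}" using assms(3) by (auto simp: disjoint_family_on_def)
    then show "ennreal (norm (\<mu> (A i))) = 0" using assms(1) by simp
  qed simp
  also have "\<dots> \<le> variation \<mu> (\<Union>i\<in>I. A i)"
    unfolding variation_def
    using assms(2-4)
    by (intro SUP_upper) (auto simp: disjoint_family_on_disjoint_image)
  finally show ?thesis .
qed

lemma variation_cong: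
  assumes "\<And>A. A \<in> sets borel \<Longrightarrow> \<mu> A = \<mu>' A" shows "variation \<mu> E = variation \<mu>' E"
  unfolding variation_def
  by (rule SUP_cong[OF refl], rule sum.cong[OF refl]) (use assms in auto)

text \<open>After the point masses on \<open>F\<close> are removed, what remains is a sum over the
  level sets cut down to \<open>- F\<close>. These partition \<open>- F\<close>, so the norms of
  their measures add up to at most \<open>c\<close>, and each is applied to a vector of norm at most
  \<open>M\<close>.\<close>

lemma simple_integral_vm_bound:
  fixes \<mu> :: "'k::t2_space set \<Rightarrow> 'x::real_normed_vector dual"
  assumes \<mu>: "\<mu> \<in> rcabv" and s: "simple_function borel s" and F: "finite F"
    and M: "\<And>t. norm (s t) \<le> M" and c: "variation \<mu> (- F) \<le> ennreal c" "c \<ge> 0"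
  shows "\<bar>simple_integral_vm \<mu> s - (\<Sum>t\<in>F. \<mu> {t} (s t))\<bar> \<le> M * c"
proof -
  have fr: "finite (range s)" and sm: "\<And>v. s -` {v} \<in> sets borel"
    using simple_functionD[OF s] by (auto simp: space_borel)
  have Fm: "F \<in> sets borel" using F by (auto intro!: borel_closed finite_imp_closed)
  have M0: "M \<ge> 0" using M[of undefined] norm_ge_zero order_trans by blast
  have "simple_integral_vm \<mu> s =
      (\<Sum>v\<in>range s. \<Sum>t\<in>F. if t \<in> s -` {v} then \<mu> {t} v else 0) + (\<Sum>v\<in>range s. \<mu> (s -` {v} - F) v)"
    unfolding simple_integral_vm_def
    by (subst rcabv_split_finite[OF \<mu> sm F])
      (simp add: blinfun.add_left blinfun.sum_left sum.distrib if_distrib[of "\<lambda>f. blinfun_apply f _"]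
        cong: if_cong)
  also have "(\<Sum>v\<in>range s. \<Sum>t\<in>F. if t \<in> s -` {v} then \<mu> {t} v else 0) = (\<Sum>t\<in>F. \<mu> {t} (s t))"
    \<comment> \<open>Each \<open>t\<close> lies in exactly one level set, so for fixed
      \<open>t\<close> only the term \<open>v = s t\<close> survives.\<close>
    by (subst sum.swap) (simp add: sum.delta fr)
  finally have eq: "simple_integral_vm \<mu> s - (\<Sum>t\<in>F. \<mu> {t} (s t)) = (\<Sum>v\<in>range s. \<mu> (s -` {v} - F) v)"
    by simp
  have "(\<Sum>v\<in>range s. ennreal (norm (\<mu> (s -` {v} - F)))) \<le> variation \<mu> (\<Union>v\<in>range s. s -` {v} - F)"
    using fr sm Fm rcabv_empty[OF \<mu>]
    by (intro sum_norm_le_variation) (auto simp: disjoint_family_on_def)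
  also have "(\<Union>v\<in>range s. s -` {v} - F) = - F" by auto
  also note c(1)
  finally have var: "(\<Sum>v\<in>range s. norm (\<mu> (s -` {v} - F))) \<le> c"
    using c(2) by (simp add: sum_ennreal)
  have "\<bar>\<Sum>v\<in>range s. \<mu> (s -` {v} - F) v\<bar> \<le> (\<Sum>v\<in>range s. norm (\<mu> (s -` {v} - F)) * M)"
  proof (rule order_trans[OF sum_abs], rule sum_mono)
    fix v assume "v \<in> range s"
    then have "norm (\<mu> (s -` {v} - F)) * norm v \<le> norm (\<mu> (s -` {v} - F)) * M"
      using M by (intro mult_left_mono) auto
    then show "\<bar>\<mu> (s -` {v} - F) v\<bar> \<le> norm (\<mu> (s -` {v} - F)) * M"
      using norm_blinfun[of "\<mu> (s -` {v} - F)" v] by simp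
  qed
  also have "\<dots> = M * (\<Sum>v\<in>range s. norm (\<mu> (s -` {v} - F)))"
    by (simp add: sum_distrib_left mult.commute)
  also have "\<dots> \<le> M * c" using var M0 by (rule mult_left_mono)
  finally show ?thesis unfolding eq .
qed

text \<open>The bound for simple functions passes to the limit: uniform approximation controls the
  sup norm up to \<open>d\<close>, and its pointwise consequence handles the finite sum over
  \<open>F\<close>.\<close>

lemma represents_functional_bound:
  fixes \<mu> :: "'k::t2_space set \<Rightarrow> 'x::real_normed_vector dual"
  assumes \<mu>: "represents_functional \<mu> \<phi>" and F: "finite F"
    and c: "variation \<mu> (- F) \<le> ennreal c" "c \<ge> 0"
  shows "\<bar>\<phi> f - (\<Sum>t\<in>F. \<mu> {t} (f t))\<bar> \<le> norm f * c"
proof (rule field_le_epsilon)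
  fix e :: real assume e: "e > 0"
  obtain s where s: "\<And>n. simple_function borel (s n)" "uniform_limit UNIV s f sequentially"
      and lim: "(\<lambda>n. simple_integral_vm \<mu> (s n)) \<longlonglongrightarrow> \<phi> f"
    using \<mu> unfolding represents_functional_def has_integral_vm_def by blast
  \<comment> \<open>The denominator \<open>c + 1\<close> keeps \<open>d\<close> well defined and
    positive also for \<open>c = 0\<close>.\<close>
  define d where "d = e / (c + 1)"
  have d: "d > 0" "d * c \<le> e" using e c(2) by (auto simp: d_def field_simps)
  have "(\<lambda>n. s n t) \<longlonglongrightarrow> f t" for t
    using s(2) by (rule tendsto_uniform_limitI) simp
  then have "(\<lambda>n. \<bar>simple_integral_vm \<mu> (s n) - (\<Sum>t\<in>F. \<mu> {t} (s n t))\<bar>) \<longlonglongrightarrow>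
      \<bar>\<phi> f - (\<Sum>t\<in>F. \<mu> {t} (f t))\<bar>"
    using lim by (intro tendsto_intros)
  moreover have "\<forall>\<^sub>F n in sequentially.
      \<bar>simple_integral_vm \<mu> (s n) - (\<Sum>t\<in>F. \<mu> {t} (s n t))\<bar> \<le> (norm f + d) * c"
    using uniform_limitD[OF s(2) d(1)]
  proof eventually_elim
    case (elim n)
    have "norm (s n t) \<le> norm f + d" for t
    proof -
      have "norm (s n t) \<le> norm (f t) + norm (s n t - f t)" by (rule norm_triangle_sub)
      also have "norm (s n t - f t) \<le> d" using elim by (auto simp: dist_norm less_imp_le)
      finally show ?thesis using norm_bounded[of f t] by simp
    qed
    then show ?case using \<mu> s(1) F c
      by (intro simple_integral_vm_bound) (auto simp: represents_functional_def)
  qed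
  ultimately have "\<bar>\<phi> f - (\<Sum>t\<in>F. \<mu> {t} (f t))\<bar> \<le> (norm f + d) * c"
    by (intro tendsto_upperbound) auto
  then show "\<bar>\<phi> f - (\<Sum>t\<in>F. \<mu> {t} (f t))\<bar> \<le> norm f * c + e"
    using d(2) by (simp add: algebra_simps)
qed

section \<open>Operators with a discrete control measure\<close>

text \<open>A functional \<open>y\<close> norming \<open>T f\<close> reduces the claim to a scalar
  one. The measure of \<open>y o\<^sub>L T\<close> agrees with the scalarization of \<open>m\<close>
  on Borel sets, so off \<open>F\<close> its variation is at most the semivariation, while at
  \<open>t\<close> in \<open>F\<close> it acts as \<open>y\<close> composed with
  \<open>S t\<close>.\<close>

lemma representing_measure_bound:
  fixes T :: "('k::t2_space \<Rightarrow>\<^sub>C 'x::real_normed_vector) \<Rightarrow>\<^sub>L 'y::real_normed_vector"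
  assumes rep: "representing_measure m T" and F: "finite F"
    and S: "\<And>t. t \<in> F \<Longrightarrow> m {t} = canonical_embedding o\<^sub>L S t"
    and c: "semivariation m (- F) \<le> ennreal c" "c \<ge> 0"
  shows "norm (T f) \<le> (\<Sum>t\<in>F. norm (S t (f t))) + norm f * c"
proof -
  obtain y :: "'y dual" where y: "norm y \<le> 1" "y (T f) = norm (T f)"
    by (rule norming_functional)
  obtain \<mu> where \<mu>: "represents_functional \<mu> (y o\<^sub>L T)"
    and m\<mu>: "\<And>A x. A \<in> sets borel \<Longrightarrow> m A x y = \<mu> A x"
    using rep unfolding representing_measure_def by blast
  have "scalarization y m A = \<mu> A" if "A \<in> sets borel" for A
    by (rule blinfun_eqI) (simp add: scalarization_def evaluation_at.rep_eq m\<mu>[OF that])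
  then have "variation \<mu> (- F) = variation (scalarization y m) (- F)"
    by (intro variation_cong) simp
  also have "\<dots> \<le> semivariation m (- F)"
    unfolding semivariation_def using y(1) by (intro SUP_upper) simp
  finally have "variation \<mu> (- F) \<le> ennreal c" using c(1) by simp
  from represents_functional_bound[OF \<mu> F this c(2), of f]
  have "norm (T f) \<le> \<bar>\<Sum>t\<in>F. \<mu> {t} (f t)\<bar> + norm f * c"
    using y(2) by simp
  also have "\<bar>\<Sum>t\<in>F. \<mu> {t} (f t)\<bar> \<le> (\<Sum>t\<in>F. norm (S t (f t)))"
  proof (rule order_trans[OF sum_abs], rule sum_mono)
    fix t assume t: "t \<in> F"
    have "\<mu> {t} (f t) = y (S t (f t))"
      using m\<mu>[of "{t}" "f t"] S[OF t]
      by (simp add: canonical_embedding.rep_eq evaluation_at.rep_eq)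
    also have "\<bar>\<dots>\<bar> \<le> norm y * norm (S t (f t))" using norm_blinfun[of y] by simp
    also have "\<dots> \<le> norm (S t (f t))" using mult_right_mono[OF y(1), of "norm (S t (f t))"] by simp
    finally show "\<bar>\<mu> {t} (f t)\<bar> \<le> norm (S t (f t))" .
  qed
  finally show ?thesis by simp
qed

lemma discrete_control_tendsto_zero:
  fixes T :: "('k::t2_space \<Rightarrow>\<^sub>C 'x::real_normed_vector) \<Rightarrow>\<^sub>L 'y::real_normed_vector"
    and f :: "nat \<Rightarrow> 'k \<Rightarrow>\<^sub>C 'x"
  assumes K: "compact (UNIV :: 'k set)" and rep: "representing_measure m T"
    and \<nu>: "control_measure \<nu> m" "discrete_measure \<nu>"
    and S: "\<And>t. m {t} = canonical_embedding o\<^sub>L S t"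
    and bdd: "bounded (range f)" and pt: "\<And>t. (\<lambda>n. S t (f n t)) \<longlonglongrightarrow> 0"
  shows "(\<lambda>n. T (f n)) \<longlonglongrightarrow> 0"
proof (rule LIMSEQ_I)
  fix e :: real assume e: "e > 0"
  obtain M where M: "M > 0" "\<And>n. norm (f n) \<le> M"
    using bdd by (auto simp: bounded_pos)
  \<comment> \<open>Chosen so that the part off \<open>F\<close> contributes at most
    \<open>M * c = e / 2\<close>, uniformly in \<open>n\<close>; \<open>F\<close> is therefore fixed
    before \<open>n\<close> grows.\<close>
  define c where "c = e / (2 * M)"
  have c: "c > 0" "M * c = e / 2" using e M(1) by (auto simp: c_def)
  have reg: "regular_borel_measure \<nu>" using \<nu>(1) by (simp add: control_measure_def)
  obtain \<delta> where \<delta>: "\<delta> > 0"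
      "\<And>A. A \<in> sets borel \<Longrightarrow> emeasure \<nu> A < ennreal \<delta> \<Longrightarrow> semivariation m A < ennreal c"
    using \<nu>(1) c(1) unfolding control_measure_def by blast
  obtain F where F: "finite F" "emeasure \<nu> (- F) < ennreal \<delta>"
    using discrete_measure_finite_approx[OF K reg \<nu>(2) \<delta>(1)] .
  have "- F \<in> sets borel" using F(1) by (intro borel_open) (simp add: open_Compl finite_imp_closed)
  then have sv: "semivariation m (- F) \<le> ennreal c" using \<delta>(2) F(2) by (simp add: less_imp_le)
  have "(\<lambda>n. \<Sum>t\<in>F. norm (S t (f n t))) \<longlonglongrightarrow> (\<Sum>t\<in>F. 0)"
    by (intro tendsto_sum tendsto_norm_zero pt)
  then have "\<forall>\<^sub>F n in sequentially. (\<Sum>t\<in>F. norm (S t (f n t))) < e / 2"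
    using e by (intro order_tendstoD(2)) auto
  then have "\<forall>\<^sub>F n in sequentially. norm (T (f n) - 0) < e"
  proof eventually_elim
    case (elim n)
    have "norm (T (f n)) \<le> (\<Sum>t\<in>F. norm (S t (f n t))) + norm (f n) * c"
      using c(1) by (intro representing_measure_bound[OF rep F(1) S sv]) simp
    also have "norm (f n) * c \<le> M * c" using M(2) c(1) by (intro mult_right_mono) auto
    finally show ?case using elim c(2) by simp
  qed
  then show "\<exists>N. \<forall>n\<ge>N. norm (T (f n) - 0) < e" by (simp add: eventually_sequentially)
qed

text \<open>The predicates \<open>V\<close> and \<open>W\<close> stand for the weak condition on
  sequences in the function space and in \<open>'x\<close>, so that one argument covers both classes
  of operators; \<open>image\<close> is the stability under bounded operators that evaluation at a
  point requires.\<close>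

lemma discrete_control_inherits:
  fixes T :: "('k::t2_space \<Rightarrow>\<^sub>C 'x::real_normed_vector) \<Rightarrow>\<^sub>L 'y::real_normed_vector"
    and V :: "(nat \<Rightarrow> 'k \<Rightarrow>\<^sub>C 'x) \<Rightarrow> bool" and W :: "(nat \<Rightarrow> 'x) \<Rightarrow> bool"
  assumes K: "compact (UNIV :: 'k set)" and rep: "representing_measure m T"
    and \<nu>: "control_measure \<nu> m" "discrete_measure \<nu>"
    and image: "\<And>L f. V f \<Longrightarrow> W (\<lambda>n. blinfun_apply L (f n))"
    and S: "\<forall>A\<in>sets borel. \<exists>S. m A = canonical_embedding o\<^sub>L S \<and>
      (\<forall>x. W x \<and> DP_set (range x) \<longrightarrow> (\<lambda>n. S (x n)) \<longlonglongrightarrow> 0)"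
    and f: "V f" "DP_set (range f)"
  shows "(\<lambda>n. T (f n)) \<longlonglongrightarrow> 0"
proof -
  \<comment> \<open>Singletons are Borel, so every point \<open>t\<close> receives its own operator,
    collected below into a function \<open>S\<close> of \<open>t\<close>.\<close>
  have "\<exists>S. m {t} = canonical_embedding o\<^sub>L S \<and>
      (\<forall>x. W x \<and> DP_set (range x) \<longrightarrow> (\<lambda>n. S (x n)) \<longlonglongrightarrow> 0)" for t
    using S by simp
  then obtain S where S: "\<And>t. m {t} = canonical_embedding o\<^sub>L S t"
    and conv: "\<And>t x. W x \<Longrightarrow> DP_set (range x) \<Longrightarrow> (\<lambda>n. S t (x n)) \<longlonglongrightarrow> 0"
    by metis
  show ?thesis
  proof (rule discrete_control_tendsto_zero[OF K rep \<nu> S])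
    show "bounded (range f)" using f(2) by (simp add: DP_set_def)
    fix t
    define ev :: "('k \<Rightarrow>\<^sub>C 'x) \<Rightarrow>\<^sub>L 'x" where "ev = Blinfun (\<lambda>g. apply_bcontfun g t)"
    have ev: "ev g = g t" for g
      by (simp add: ev_def bounded_linear_Blinfun_apply bounded_linear_bcontfun_eval)
    have "W (\<lambda>n. f n t)" using image[OF f(1), of ev] by (simp add: ev)
    moreover have "DP_set (range (\<lambda>n. f n t))"
      using DP_set_image[OF f(2), of ev] by (simp add: image_image ev)
    ultimately show "(\<lambda>n. S t (f n t)) \<longlonglongrightarrow> 0" by (rule conv)
  qed
qed

theorem theorem15:
  fixes p :: real
    and T :: "('k::t2_space \<Rightarrow>\<^sub>C 'x::banach) \<Rightarrow>\<^sub>L 'y::banach"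
    and m :: "'k set \<Rightarrow> ('x \<Rightarrow>\<^sub>L 'y bidual)"
    and \<nu> :: "'k measure"
  assumes "1 \<le> p"
    and "compact (UNIV :: 'k set)"
    and "representing_measure m T"
    and "strongly_bounded m"
    and "control_measure \<nu> m"
    and "discrete_measure \<nu>"
  shows
    "((\<forall>A \<in> sets borel. \<exists>S :: 'x \<Rightarrow>\<^sub>L 'y.
         m A = canonical_embedding o\<^sub>L S \<and> pseudo_weakly_compact S) \<longrightarrow>
       pseudo_weakly_compact T) \<and>
     ((\<forall>A \<in> sets borel. \<exists>S :: 'x \<Rightarrow>\<^sub>L 'y.
         m A = canonical_embedding o\<^sub>L S \<and> DP_p_convergent p S) \<longrightarrow>
       DP_p_convergent p T)"
proof (intro conjI impI)
  \<comment> \<open>In each instance \<open>V\<close> and \<open>W\<close> are the same predicate,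
    read at two different types.\<close>
  note inherits = discrete_control_inherits[OF assms(2,3,5,6)]
  show "pseudo_weakly_compact T"
    if "\<forall>A \<in> sets borel. \<exists>S :: 'x \<Rightarrow>\<^sub>L 'y.
      m A = canonical_embedding o\<^sub>L S \<and> pseudo_weakly_compact S"
    using inherits[of weakly_null weakly_null, OF weakly_null_image] that
    by (simp add: pseudo_weakly_compact_def)
  show "DP_p_convergent p T"
    if "\<forall>A \<in> sets borel. \<exists>S :: 'x \<Rightarrow>\<^sub>L 'y.
      m A = canonical_embedding o\<^sub>L S \<and> DP_p_convergent p S"
    using inherits[of "weakly_p_summable p" "weakly_p_summable p", OF weakly_p_summable_image] that
    by (simp add: DP_p_convergent_def)
qed

end
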